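(* Let $k>0$ and $\delta>0$ be arbitrary real numbers, put $\rho=k\delta^{-1}$, and set $g(u)=u(1-u)$. Let $X_1,\dots,X_n$ be independent identically distributed real-valued random variables with common distribution function $F$, and let $X_{1:n}\le\dots\le X_{n:n}$ be the corresponding order statistics. Then for all $n\ge 2\rho+1$ and for all $i$ such that $\rho\le i\le n-\rho+1$ the following inequality holds: $$\mathbf{E}|X_{i:n}|^k < C(\rho)\left\{\mathbf{E}|X_1|^{\delta}\, g^{-1}\Bigl(\frac{i}{n+1}\Bigr)\right\}^{\rho},$$ where one can put $C(\rho)=2\sqrt{\rho}\,\exp(\rho+7/6)$.
   Context: The order statistics $X_{1:n}\le\dots\le X_{n:n}$ are the values $X_1,\dots,X_n$ arranged in non-decreasing order, so $X_{i:n}$ is the $i$-th smallest. Here $n$ and $i$ are positive integers with $1\le i\le n$. The symbol $g^{-1}(u)$ denotes the reciprocal $1/g(u)=1/(u(1-u))$, not the inverse function. $\mathbf{E}$ denotes expectation.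
   Formalization: Assumes 0 < E|X_1|^δ < ∞ (strict inequality fails for X_1 = 0 a.s.; both sides may be infinite otherwise) and replaces C(ρ) by max(1, C(ρ)), as the bound is false when C(ρ) < 1, e.g. X_j = 1, δ = 1, k = 0.01, n = 2, i = 1. *)

theory Defs
  imports "HOL-Probability.Probability"
begin

(* The i-th smallest (1 <= i <= n) of X 1 w, ..., X n w, counted with multiplicity. *)
definition order_stat :: "(nat \<Rightarrow> 'a \<Rightarrow> real) \<Rightarrow> nat \<Rightarrow> nat \<Rightarrow> 'a \<Rightarrow> real" where
  "order_stat X n i w = sort (map (\<lambda>j. X j w) [1..<Suc n]) ! (i - 1)"

definition g :: "real \<Rightarrow> real" where
  "g u = u * (1 - u)"

(* C rho >= 1 holds exactly from about rho = 0.0232 on.  Where C rho < 1 it is too small to be a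
   constant in the moment bound: for X constantly 1 the left-hand side is 1, whereas the bound
   C rho * (1 / g (i/(n+1))) powr rho is about 0.66 for rho = 1/100, n = 2, i = 1.
   The bound is therefore used with max 1 (C rho), which is C rho as soon as C rho >= 1. *)
definition C :: "real \<Rightarrow> real" where
  "C \<rho> = 2 * sqrt \<rho> * exp (\<rho> + 7/6)"

end

theory Submission
  imports Defs
begin

text \<open>
  The moment bound is a statement about elementary symmetric polynomials. Put
  \<open>Y\<^sub>j = \<bar>X\<^sub>j\<bar> powr \<delta>\<close>, \<open>\<mu> = E Y\<^sub>1\<close> and \<open>r = min i (n + 1 - i)\<close>. If the \<open>i\<close>-th order statistic \<open>x\<close> is
  negative, the \<open>i\<close> values to its left are at least as large in modulus, and if \<open>x\<close> is nonnegative,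
  the \<open>n + 1 - i\<close> values to its right are. In both cases at least \<open>r\<close> of the \<open>Y\<^sub>j\<close> are at least
  \<open>y = \<bar>x\<bar> powr \<delta>\<close> (\<open>card_abs_ge_order_stat\<close>), and hence, for every \<open>m \<le> r\<close>, at least
  \<open>r choose m\<close> of the monomials in the elementary symmetric polynomial \<open>e\<^sub>m(Y\<^sub>1, \<dots>, Y\<^sub>n)\<close> are at
  least \<open>y ^ m\<close>. By independence \<open>E e\<^sub>m = (n choose m) * \<mu> ^ m\<close>, so

    \<open>E (y ^ m) \<le> (n choose m) / (r choose m) * \<mu> ^ m\<close>.

  The restriction on \<open>i\<close> says \<open>\<rho> \<le> r\<close>; since \<open>r\<close> is an integer, even \<open>m = \<lceil>\<rho>\<rceil> \<le> r\<close>. Jensen's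
  inequality for the concave function \<open>z powr (\<rho> / m)\<close> then passes from the integer exponent \<open>m\<close> to
  \<open>\<rho>\<close> (\<open>order_stat_moment_le\<close>).

  The quotient of binomial coefficients is at most \<open>(n / r) ^ m * (m ^ m / m!)\<close>, and
  \<open>n / r < 1 / g (i / (n + 1))\<close>, which is where strictness comes from. The remaining factor
  \<open>(m ^ m / m!) powr (\<rho> / m)\<close> is \<open>1\<close> for \<open>m = 1\<close>, that is for \<open>\<rho> \<le> 1\<close>, and otherwise it is at most
  \<open>exp \<rho>\<close>, because \<open>m ^ m / m!\<close> is a single term of the series of \<open>exp m\<close>.
\<close>

section \<open>The rank of an order statistic\<close>

lemma card_values_eq_card_positions:
  "card {j \<in> {1..n}. P (X j w)} =
   card {p. p < n \<and> P (sort (map (\<lambda>j. X j w) [1..<Suc n]) ! p)}"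
proof -
  let ?xs = "map (\<lambda>j. X j w) [1..<Suc n]"
  have "card {j \<in> {1..n}. P (X j w)} = length (filter (\<lambda>j. P (X j w)) [1..<Suc n])"
  proof -
    have "{j \<in> {1..n}. P (X j w)} = set (filter (\<lambda>j. P (X j w)) [1..<Suc n])"
      by auto
    then show ?thesis
      by (simp only: distinct_card[OF distinct_filter[OF distinct_upt]])
  qed
  also have "\<dots> = length (filter P ?xs)"
    by (simp add: filter_map o_def del: upt_Suc)
  also have "\<dots> = length (filter P (sort ?xs))"
    by (rule mset_eq_length) (simp del: upt_Suc)
  also have "\<dots> = card {p. p < length (sort ?xs) \<and> P (sort ?xs ! p)}"
    by (rule length_filter_conv_card)
  finally show ?thesis
    by simp
qed

lemma card_le_order_stat:
  assumes "1 \<le> i" "i \<le> n"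
  shows "i \<le> card {j \<in> {1..n}. X j w \<le> order_stat X n i w}"
proof -
  let ?ys = "sort (map (\<lambda>j. X j w) [1..<Suc n])"
  have "{..<i} \<subseteq> {p. p < n \<and> ?ys ! p \<le> ?ys ! (i - 1)}"
    using assms by (auto intro!: sorted_nth_mono simp del: upt_Suc)
  then have "card {..<i} \<le> card {p. p < n \<and> ?ys ! p \<le> ?ys ! (i - 1)}"
    by (intro card_mono) auto
  then show ?thesis
    unfolding order_stat_def card_values_eq_card_positions[of n "\<lambda>x. x \<le> _"] by simp
qed

lemma card_ge_order_stat:
  assumes "1 \<le> i" "i \<le> n"
  shows "n + 1 - i \<le> card {j \<in> {1..n}. order_stat X n i w \<le> X j w}"
proof -
  let ?ys = "sort (map (\<lambda>j. X j w) [1..<Suc n])"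
  have "{i - 1..<n} \<subseteq> {p. p < n \<and> ?ys ! (i - 1) \<le> ?ys ! p}"
    using assms by (auto intro!: sorted_nth_mono simp del: upt_Suc)
  then have "card {i - 1..<n} \<le> card {p. p < n \<and> ?ys ! (i - 1) \<le> ?ys ! p}"
    by (intro card_mono) auto
  then show ?thesis
    using assms
    unfolding order_stat_def card_values_eq_card_positions[of n "\<lambda>x. _ \<le> x"] by simp
qed

text \<open>
  The values on the far side of the order statistic, as seen from \<open>0\<close>, exceed it in modulus; which
  side that is depends on its sign.
\<close>

lemma card_abs_ge_order_stat:
  assumes "1 \<le> i" "i \<le> n"
  shows "min i (n + 1 - i) \<le> card {j \<in> {1..n}. \<bar>order_stat X n i w\<bar> \<le> \<bar>X j w\<bar>}"
proof (cases "order_stat X n i w < 0")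
  case True
  then have "card {j \<in> {1..n}. X j w \<le> order_stat X n i w}
      \<le> card {j \<in> {1..n}. \<bar>order_stat X n i w\<bar> \<le> \<bar>X j w\<bar>}"
    by (intro card_mono) auto
  with card_le_order_stat[OF assms, of X w] show ?thesis
    by simp
next
  case False
  then have "card {j \<in> {1..n}. order_stat X n i w \<le> X j w}
      \<le> card {j \<in> {1..n}. \<bar>order_stat X n i w\<bar> \<le> \<bar>X j w\<bar>}"
    by (intro card_mono) auto
  with card_ge_order_stat[OF assms, of X w] show ?thesis
    by simp
qed

lemma order_stat_le_iff:
  assumes "1 \<le> i" "i \<le> n"
  shows "order_stat X n i w \<le> a \<longleftrightarrow> i \<le> card {j \<in> {1..n}. X j w \<le> a}"
proof
  assume "order_stat X n i w \<le> a"
  then have "card {j \<in> {1..n}. X j w \<le> order_stat X n i w} \<le> card {j \<in> {1..n}. X j w \<le> a}"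
    by (intro card_mono) auto
  with card_le_order_stat[OF assms, of X w] show "i \<le> card {j \<in> {1..n}. X j w \<le> a}"
    by simp
next
  assume i: "i \<le> card {j \<in> {1..n}. X j w \<le> a}"
  show "order_stat X n i w \<le> a"
  proof (rule ccontr)
    assume "\<not> order_stat X n i w \<le> a"
    then have "{j \<in> {1..n}. X j w \<le> a} \<inter> {j \<in> {1..n}. order_stat X n i w \<le> X j w} = {}"
      by auto
    then have "card {j \<in> {1..n}. X j w \<le> a} + card {j \<in> {1..n}. order_stat X n i w \<le> X j w}
        = card ({j \<in> {1..n}. X j w \<le> a} \<union> {j \<in> {1..n}. order_stat X n i w \<le> X j w})"
      by (subst card_Un_disjoint) auto
    also have "\<dots> \<le> card {1..n}"
      by (intro card_mono) auto
    finally show False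
      using i card_ge_order_stat[OF assms, of X w] assms by simp
  qed
qed

lemma borel_measurable_order_stat:
  assumes "\<And>j. j \<in> {1..n} \<Longrightarrow> X j \<in> borel_measurable M" "1 \<le> i" "i \<le> n"
  shows "order_stat X n i \<in> borel_measurable M"
  unfolding borel_measurable_iff_le
proof
  fix a
  have count: "real (card {j \<in> {1..n}. X j w \<le> a}) = (\<Sum>j\<in>{1..n}. indicator {..a} (X j w))" for w
    by (simp add: indicator_def Int_def)
  have "order_stat X n i w \<le> a \<longleftrightarrow> real i \<le> (\<Sum>j\<in>{1..n}. indicator {..a} (X j w))" for w
    unfolding order_stat_le_iff[OF assms(2,3)] count[symmetric] by simp
  then have "{w \<in> space M. order_stat X n i w \<le> a}
      = {w \<in> space M. real i \<le> (\<Sum>j\<in>{1..n}. indicator {..a} (X j w))}"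
    by simp
  also have "\<dots> \<in> sets M"
  proof -
    have "(\<lambda>w. \<Sum>j\<in>{1..n}. indicator {..a} (X j w) :: real) \<in> borel_measurable M"
      using assms(1) by (intro borel_measurable_sum) measurable
    then show ?thesis
      by measurable
  qed
  finally show "{w \<in> space M. order_stat X n i w \<le> a} \<in> sets M" .
qed

section \<open>Elementary symmetric polynomials\<close>

definition elem_sym :: "('b \<Rightarrow> real) \<Rightarrow> nat \<Rightarrow> 'b set \<Rightarrow> real" where
  "elem_sym y m I = (\<Sum>A | A \<subseteq> I \<and> card A = m. \<Prod>j\<in>A. y j)"

text \<open>
  Each of the \<open>card J choose m\<close> monomials supported in \<open>J\<close> is at least \<open>c ^ m\<close>, and the other
  monomials are nonnegative.
\<close>

lemma binomial_power_le_elem_sym: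
  assumes "finite I" "J \<subseteq> I" "0 \<le> c"
    and "\<And>j. j \<in> I \<Longrightarrow> 0 \<le> y j" "\<And>j. j \<in> J \<Longrightarrow> c \<le> y j"
  shows "real (card J choose m) * c ^ m \<le> elem_sym y m I"
proof -
  have "finite J"
    using assms finite_subset by blast
  have "real (card J choose m) * c ^ m = (\<Sum>A | A \<subseteq> J \<and> card A = m. c ^ m)"
    using n_subsets[OF \<open>finite J\<close>, of m] by simp
  also have "\<dots> \<le> (\<Sum>A | A \<subseteq> J \<and> card A = m. \<Prod>j\<in>A. y j)"
  proof (rule sum_mono)
    fix A assume A: "A \<in> {A. A \<subseteq> J \<and> card A = m}"
    then have "c ^ m = (\<Prod>j\<in>A. c)"
      by simp
    also have "\<dots> \<le> (\<Prod>j\<in>A. y j)"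
      using A assms by (intro prod_mono) auto
    finally show "c ^ m \<le> (\<Prod>j\<in>A. y j)" .
  qed
  also have "\<dots> \<le> elem_sym y m I"
    unfolding elem_sym_def using assms
    by (intro sum_mono2) (auto intro!: prod_nonneg)
  finally show ?thesis .
qed

context prob_space
begin

lemma elem_sym_indep:
  fixes Y :: "'b \<Rightarrow> 'a \<Rightarrow> real"
  assumes "finite I" and indep: "indep_vars (\<lambda>_. borel) Y I"
    and "\<And>j. j \<in> I \<Longrightarrow> integrable M (Y j)" "\<And>j. j \<in> I \<Longrightarrow> expectation (Y j) = \<mu>"
  shows integrable_elem_sym_indep: "integrable M (\<lambda>w. elem_sym (\<lambda>j. Y j w) m I)"
    and expectation_elem_sym_indep:
      "expectation (\<lambda>w. elem_sym (\<lambda>j. Y j w) m I) = real (card I choose m) * \<mu> ^ m"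
proof -
  have int: "integrable M (\<lambda>w. \<Prod>j\<in>A. Y j w)"
    and expect: "expectation (\<lambda>w. \<Prod>j\<in>A. Y j w) = \<mu> ^ card A" if "A \<subseteq> I" for A
  proof -
    have A: "finite A" "indep_vars (\<lambda>_. borel) Y A" "\<And>j. j \<in> A \<Longrightarrow> integrable M (Y j)"
      using assms that finite_subset indep_vars_subset[OF indep that] by auto
    show "integrable M (\<lambda>w. \<Prod>j\<in>A. Y j w)"
      by (rule indep_vars_integrable[OF A])
    have "expectation (\<lambda>w. \<Prod>j\<in>A. Y j w) = (\<Prod>j\<in>A. expectation (Y j))"
      by (rule indep_vars_lebesgue_integral[OF A])
    also have "\<dots> = (\<Prod>j\<in>A. \<mu>)"
      using assms(4) that by (intro prod.cong) auto
    finally show "expectation (\<lambda>w. \<Prod>j\<in>A. Y j w) = \<mu> ^ card A"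
      by simp
  qed
  show "integrable M (\<lambda>w. elem_sym (\<lambda>j. Y j w) m I)"
    unfolding elem_sym_def using int by auto
  have "expectation (\<lambda>w. elem_sym (\<lambda>j. Y j w) m I)
      = (\<Sum>A | A \<subseteq> I \<and> card A = m. expectation (\<lambda>w. \<Prod>j\<in>A. Y j w))"
    unfolding elem_sym_def using int by (intro Bochner_Integration.integral_sum) auto
  also have "\<dots> = (\<Sum>A | A \<subseteq> I \<and> card A = m. \<mu> ^ m)"
    using expect by (intro sum.cong) auto
  also have "\<dots> = real (card I choose m) * \<mu> ^ m"
    using n_subsets[OF \<open>finite I\<close>, of m] by simp
  finally show "expectation (\<lambda>w. elem_sym (\<lambda>j. Y j w) m I) = real (card I choose m) * \<mu> ^ m" .
qed

section \<open>Moments of order statistics\<close>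

lemma identically_distributed_of_cdf_eq:
  fixes X Y :: "'a \<Rightarrow> real" and h :: "real \<Rightarrow> real"
  assumes [measurable]: "random_variable borel X" "random_variable borel Y" "h \<in> borel_measurable borel"
    and "cdf (distr M borel X) = cdf (distr M borel Y)"
  shows "integrable M (\<lambda>w. h (X w)) \<longleftrightarrow> integrable M (\<lambda>w. h (Y w))"
    and "expectation (\<lambda>w. h (X w)) = expectation (\<lambda>w. h (Y w))"
proof -
  have eq: "distr M borel X = distr M borel Y"
    using assms by (intro cdf_unique real_distribution_distr) auto
  have "integrable (distr M borel X) h \<longleftrightarrow> integrable M (\<lambda>w. h (X w))"
       "integrable (distr M borel Y) h \<longleftrightarrow> integrable M (\<lambda>w. h (Y w))"
    by (auto intro!: integrable_distr_eq)
  with eq show "integrable M (\<lambda>w. h (X w)) \<longleftrightarrow> integrable M (\<lambda>w. h (Y w))"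
    by simp
  have "integral\<^sup>L (distr M borel X) h = expectation (\<lambda>w. h (X w))"
       "integral\<^sup>L (distr M borel Y) h = expectation (\<lambda>w. h (Y w))"
    by (auto intro!: integral_distr)
  with eq show "expectation (\<lambda>w. h (X w)) = expectation (\<lambda>w. h (Y w))"
    by simp
qed

text \<open>
  Jensen's inequality for the concave function \<open>z powr s\<close> on the closed half-line: the bound is
  the expectation of the tangent at \<open>c = expectation Z\<close>.
\<close>

lemma powr_moment_le:
  fixes V Z :: "'a \<Rightarrow> real"
  assumes [measurable]: "random_variable borel V" and Z: "integrable M Z"
    and "\<And>w. 0 \<le> V w" "\<And>w. V w \<le> Z w" "0 < expectation Z" "0 < s" "s \<le> 1"
  shows "integrable M (\<lambda>w. V w powr s)"
    and "expectation (\<lambda>w. V w powr s) \<le> expectation Z powr s"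
proof -
  define c where "c = expectation Z"
  have "c > 0"
    using assms by (simp add: c_def)
  have tangent: "z powr s \<le> c powr s * (s * (z / c) + (1 - s))" if "0 \<le> z" for z
  proof (cases "z = 0")
    case True
    with \<open>s \<le> 1\<close> show ?thesis by simp
  next
    case False
    with that \<open>c > 0\<close> have "0 < z / c" by simp
    then have "(z / c) powr s * 1 powr (1 - s) \<le> s * (z / c) + (1 - s) * 1"
      using assms by (intro Youngs_inequality_0) auto
    then have "c powr s * (z / c) powr s \<le> c powr s * (s * (z / c) + (1 - s))"
      by (intro mult_left_mono) auto
    with that \<open>c > 0\<close> show ?thesis
      by (simp add: powr_divide)
  qed
  have bound: "V w powr s \<le> c powr s * (s * (Z w / c) + (1 - s))" for w
  proof -
    have "V w powr s \<le> Z w powr s"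
      using assms by (intro powr_mono2) auto
    also have "\<dots> \<le> c powr s * (s * (Z w / c) + (1 - s))"
      using assms(3,4)[of w] by (intro tangent) simp
    finally show ?thesis .
  qed
  have int: "integrable M (\<lambda>w. c powr s * (s * (Z w / c) + (1 - s)))"
    using Z by auto
  show intV: "integrable M (\<lambda>w. V w powr s)"
  proof (rule Bochner_Integration.integrable_bound[OF int])
    show "AE w in M. norm (V w powr s) \<le> norm (c powr s * (s * (Z w / c) + (1 - s)))"
    proof (rule AE_I2)
      fix w
      show "norm (V w powr s) \<le> norm (c powr s * (s * (Z w / c) + (1 - s)))"
        using bound[of w] powr_ge_zero[of "V w" s] by simp
    qed
  qed measurable
  have "expectation (\<lambda>w. V w powr s) \<le> expectation (\<lambda>w. c powr s * (s * (Z w / c) + (1 - s)))"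
    using intV int bound by (intro integral_mono) auto
  also have "\<dots> = c powr s * (s * (c / c) + (1 - s))"
    using Z by (simp add: c_def prob_space)
  also have "\<dots> = expectation Z powr s"
    using \<open>c > 0\<close> by (simp add: c_def)
  finally show "expectation (\<lambda>w. V w powr s) \<le> expectation Z powr s" .
qed

text \<open>
  For integer \<open>\<rho> = m\<close> this compares \<open>\<bar>order_stat X n i w\<bar> powr (\<delta> * m)\<close> with the \<open>m\<close>-th
  elementary symmetric polynomial in the \<open>\<bar>X j w\<bar> powr \<delta>\<close>; smaller \<open>\<rho>\<close> follow by concavity.
\<close>

lemma order_stat_moment_le:
  fixes X :: "nat \<Rightarrow> 'a \<Rightarrow> real" and \<mu> \<delta> \<rho> :: real and i m n :: nat
  defines "\<mu> \<equiv> expectation (\<lambda>w. \<bar>X 1 w\<bar> powr \<delta>)"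
    and "r \<equiv> min i (n + 1 - i)"
  assumes indep: "indep_vars (\<lambda>_. borel) X {1..n}"
    and cdf: "\<And>j. j \<in> {1..n} \<Longrightarrow> cdf (distr M borel (X j)) = F"
    and i: "1 \<le> i" "i \<le> n" and m: "1 \<le> m" "m \<le> r"
    and "0 < \<delta>" "0 < \<rho>" "\<rho> \<le> real m"
    and int: "integrable M (\<lambda>w. \<bar>X 1 w\<bar> powr \<delta>)" and "0 < \<mu>"
  shows "integrable M (\<lambda>w. \<bar>order_stat X n i w\<bar> powr (\<delta> * \<rho>))"
    and "expectation (\<lambda>w. \<bar>order_stat X n i w\<bar> powr (\<delta> * \<rho>))
      \<le> (real (n choose m) / real (r choose m) * \<mu> ^ m) powr (\<rho> / real m)"
proof -
  define Y where "Y j w = \<bar>X j w\<bar> powr \<delta>" for j w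
  define V where "V w = \<bar>order_stat X n i w\<bar> powr (\<delta> * real m)" for w
  define Z where "Z w = elem_sym (\<lambda>j. Y j w) m {1..n} / real (r choose m)" for w
  have X: "random_variable borel (X j)" if "j \<in> {1..n}" for j
    using indep that by (simp add: indep_vars_def2)
  have "m \<le> n"
    using i m by (simp add: r_def)
  have binom: "0 < n choose m" "0 < r choose m"
    using m \<open>m \<le> n\<close> by auto
  have Y_indep: "indep_vars (\<lambda>_. borel) Y {1..n}"
    unfolding Y_def by (rule indep_vars_compose2[OF indep]) measurable
  have Y: "integrable M (Y j)" "expectation (Y j) = \<mu>" if "j \<in> {1..n}" for j
  proof -
    have "cdf (distr M borel (X j)) = cdf (distr M borel (X 1))"
      using cdf that i by simp
    from identically_distributed_of_cdf_eq[OF X X _ this, of "\<lambda>x. \<bar>x\<bar> powr \<delta>"] that i int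
    show "integrable M (Y j)" "expectation (Y j) = \<mu>"
      unfolding Y_def \<mu>_def by auto
  qed
  have Z_int: "integrable M Z"
    unfolding Z_def using integrable_elem_sym_indep[OF _ Y_indep Y] by auto
  have EZ: "expectation Z = real (n choose m) / real (r choose m) * \<mu> ^ m"
    unfolding Z_def using expectation_elem_sym_indep[OF _ Y_indep Y] by simp
  have os [measurable]: "random_variable borel (order_stat X n i)"
    using X i by (intro borel_measurable_order_stat) auto
  have V_meas: "random_variable borel V"
    unfolding V_def by measurable
  have V_le_Z: "V w \<le> Z w" for w
  proof -
    define J where "J = {j \<in> {1..n}. \<bar>order_stat X n i w\<bar> \<le> \<bar>X j w\<bar>}"
    have "r \<le> card J"
      unfolding J_def r_def using card_abs_ge_order_stat[OF i] .
    have "V w = (\<bar>order_stat X n i w\<bar> powr \<delta>) ^ m"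
      using m by (simp add: V_def powr_powr flip: powr_realpow')
    then have "real (r choose m) * V w
        \<le> real (card J choose m) * (\<bar>order_stat X n i w\<bar> powr \<delta>) ^ m"
      using binomial_right_mono[OF \<open>r \<le> card J\<close>, of m] by (auto intro!: mult_right_mono)
    also have "\<dots> \<le> elem_sym (\<lambda>j. Y j w) m {1..n}"
      using \<open>0 < \<delta>\<close>
      by (intro binomial_power_le_elem_sym) (auto simp: J_def Y_def intro!: powr_mono2)
    finally show ?thesis
      using binom by (simp add: Z_def field_simps)
  qed
  have EZ_pos: "0 < expectation Z"
    unfolding EZ using binom \<open>0 < \<mu>\<close> by simp
  have V_powr: "V w powr (\<rho> / real m) = \<bar>order_stat X n i w\<bar> powr (\<delta> * \<rho>)" for w
    using m by (simp add: V_def powr_powr)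
  have s: "0 < \<rho> / real m" "\<rho> / real m \<le> 1" and V_nonneg: "\<And>w. 0 \<le> V w"
    using m \<open>0 < \<rho>\<close> \<open>\<rho> \<le> real m\<close> by (simp_all add: V_def)
  note moment = powr_moment_le[OF V_meas Z_int V_nonneg V_le_Z EZ_pos s]
  show "integrable M (\<lambda>w. \<bar>order_stat X n i w\<bar> powr (\<delta> * \<rho>))"
    using moment(1) by (simp only: V_powr)
  show "expectation (\<lambda>w. \<bar>order_stat X n i w\<bar> powr (\<delta> * \<rho>))
      \<le> (real (n choose m) / real (r choose m) * \<mu> ^ m) powr (\<rho> / real m)"
    using moment(2) by (simp only: V_powr EZ)
qed

end

section \<open>The constants\<close>

lemma power_over_fact_le_exp:
  fixes x :: real
  assumes "0 \<le> x"
  shows "x ^ m / fact m \<le> exp x"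
proof -
  have "(\<Sum>k\<in>{m}. inverse (fact k) *\<^sub>R x ^ k) \<le> (\<Sum>k. inverse (fact k) *\<^sub>R x ^ k)"
    using assms by (intro sum_le_suminf summable_exp_generic) auto
  then show ?thesis
    by (simp add: exp_def divide_inverse mult.commute)
qed

lemma binomial_quotient_le:
  assumes "1 \<le> m" "m \<le> r"
  shows "real (n choose m) / real (r choose m) \<le> (real n / real r) ^ m * (real m ^ m / fact m)"
proof -
  have "real ((n choose m) * fact m) \<le> real (n ^ m)"
    using binomial_fact_pow[of n m] by (simp only: of_nat_le_iff)
  then have "real (n choose m) \<le> real n ^ m / fact m"
    by (simp add: pos_le_divide_eq)
  moreover have "(real r / real m) ^ m \<le> real (r choose m)"
    using assms(2) by (rule binomial_ge_n_over_k_pow_k)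
  ultimately have "real (n choose m) / real (r choose m) \<le> (real n ^ m / fact m) / (real r / real m) ^ m"
    using assms by (intro frac_le) auto
  also have "\<dots> = (real n / real r) ^ m * (real m ^ m / fact m)"
    by (simp add: power_divide)
  finally show ?thesis .
qed

text \<open>
  For \<open>\<rho> \<le> 1\<close> the left-hand side is \<open>1\<close>, which is what the maximum with \<open>1\<close> provides for. For
  \<open>\<rho> > 1\<close> it is at most \<open>exp \<rho>\<close>, and the factor \<open>2 * sqrt \<rho> * exp (7/6)\<close> of \<open>C \<rho>\<close> exceeds \<open>1\<close>.
\<close>

lemma power_over_fact_powr_le_C:
  assumes "0 < \<rho>" and m: "m = nat \<lceil>\<rho>\<rceil>"
  shows "(real m ^ m / fact m) powr (\<rho> / real m) \<le> max 1 (C \<rho>)"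
proof (cases "\<rho> \<le> 1")
  case True
  with assms have "\<lceil>\<rho>\<rceil> = 1"
    by (intro ceiling_unique) auto
  with m show ?thesis by simp
next
  case False
  then have "0 < m"
    using m by simp
  have "(real m ^ m / fact m) powr (\<rho> / real m) \<le> exp (real m) powr (\<rho> / real m)"
    using assms by (intro powr_mono2 power_over_fact_le_exp) auto
  also have "\<dots> = exp \<rho>"
    using \<open>0 < m\<close> by (simp add: powr_def)
  also have "\<dots> \<le> C \<rho>"
  proof -
    have "1 \<le> 2 * sqrt \<rho>"
      using False real_sqrt_ge_one[of \<rho>] by linarith
    then have "1 * exp \<rho> \<le> (2 * sqrt \<rho>) * exp (\<rho> + 7/6)"
      using False by (intro mult_mono) auto
    then show ?thesis
      by (simp add: C_def)
  qed
  finally show ?thesis by simp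
qed

text \<open>
  With \<open>r = min i (n + 1 - i)\<close> and \<open>r' = n + 1 - r \<le> n\<close> the right-hand side is
  \<open>(n + 1)\<^sup>2 / (r * r')\<close>.
\<close>

lemma sample_size_over_rank_less:
  assumes "1 \<le> i" "i \<le> n"
  shows "real n / real (min i (n + 1 - i)) < 1 / g (real i / (real n + 1))"
proof -
  define r where "r = min i (n + 1 - i)"
  define r' where "r' = n + 1 - r"
  have pos: "0 < r" "0 < r'" and "r' \<le> n"
    using assms by (auto simp: r_def r'_def min_def)
  have "i * (n + 1 - i) = r * r'"
    using assms by (auto simp: r_def r'_def min_def)
  then have "real i * real (n + 1 - i) = real r * real r'"
    by (simp only: flip: of_nat_mult)
  then have "real i * (real n + 1 - real i) = real r * real r'"
    using assms by (simp add: Suc_diff_le algebra_simps)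
  moreover have "g (real i / (real n + 1)) = real i * (real n + 1 - real i) / (real n + 1)\<^sup>2"
    by (simp add: g_def field_simps power2_eq_square)
  ultimately have g: "1 / g (real i / (real n + 1)) = (real n + 1)\<^sup>2 / (real r * real r')"
    by simp
  have "real n * real r' \<le> real n * real n"
    using \<open>r' \<le> n\<close> by (intro mult_left_mono) auto
  also have "\<dots> < (real n + 1)\<^sup>2"
    by (simp add: power2_eq_square algebra_simps)
  finally have "real n / real r < (real n + 1)\<^sup>2 / (real r * real r')"
    using pos by (simp add: field_simps)
  then show ?thesis
    by (simp only: g r_def)
qed

theorem theorem1:
  fixes M :: "'a measure" and X :: "nat \<Rightarrow> 'a \<Rightarrow> real" and F :: "real \<Rightarrow> real"
    and k \<delta> \<rho> :: real and n i :: nat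
  assumes "prob_space M"
    and "k > 0" and "\<delta> > 0" and "\<rho> = k / \<delta>"
    and "prob_space.indep_vars M (\<lambda>_. borel) X {1..n}"
    and "\<And>j. j \<in> {1..n} \<Longrightarrow> cdf (distr M borel (X j)) = F"
    and "1 \<le> i" and "i \<le> n"
    and "real n \<ge> 2 * \<rho> + 1"
    and "\<rho> \<le> real i" and "real i \<le> real n - \<rho> + 1"
    and "integrable M (\<lambda>w. \<bar>X 1 w\<bar> powr \<delta>)"
    and "(\<integral>w. \<bar>X 1 w\<bar> powr \<delta> \<partial>M) > 0"
  shows "integrable M (\<lambda>w. \<bar>order_stat X n i w\<bar> powr k) \<and>
    (\<integral>w. \<bar>order_stat X n i w\<bar> powr k \<partial>M)
      < max 1 (C \<rho>) * ((\<integral>w. \<bar>X 1 w\<bar> powr \<delta> \<partial>M) * (1 / g (real i / (real n + 1)))) powr \<rho>"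
proof -
  interpret prob_space M by fact
  define \<mu> where "\<mu> = (\<integral>w. \<bar>X 1 w\<bar> powr \<delta> \<partial>M)"
  define m where "m = nat \<lceil>\<rho>\<rceil>"
  define r where "r = min i (n + 1 - i)"
  define G where "G = 1 / g (real i / (real n + 1))"
  have "0 < \<rho>" and k: "k = \<delta> * \<rho>"
    using assms by simp_all
  have "0 < \<mu>"
    using assms by (simp add: \<mu>_def)
  have m: "1 \<le> m" "\<rho> \<le> real m"
    using \<open>0 < \<rho>\<close> by (simp_all add: m_def Suc_le_eq real_nat_ceiling_ge)
  have "\<rho> \<le> real r"
    using assms by (auto simp: r_def min_def)
  then have "m \<le> r"
    by (simp add: m_def ceiling_le_iff nat_le_iff)
  have "real n / real r < G"
    unfolding r_def G_def using assms by (intro sample_size_over_rank_less)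
  note moment = order_stat_moment_le[OF assms(5-8) m(1) \<open>m \<le> r\<close>[unfolded r_def]
      assms(3) \<open>0 < \<rho>\<close> m(2) assms(12,13)]
  have "(\<integral>w. \<bar>order_stat X n i w\<bar> powr k \<partial>M)
      \<le> (real (n choose m) / real (r choose m) * \<mu> ^ m) powr (\<rho> / real m)"
    using moment(2) by (simp add: k r_def \<mu>_def)
  also have "\<dots> \<le> ((real n / real r) ^ m * (real m ^ m / fact m) * \<mu> ^ m) powr (\<rho> / real m)"
    using \<open>0 < \<rho>\<close> \<open>0 < \<mu>\<close> m \<open>m \<le> r\<close>
    by (intro powr_mono2 mult_right_mono binomial_quotient_le) auto
  also have "\<dots> = ((real m ^ m / fact m) * (\<mu> * (real n / real r)) ^ m) powr (\<rho> / real m)"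
    by (simp add: power_mult_distrib power_divide mult_ac)
  also have "\<dots> = (real m ^ m / fact m) powr (\<rho> / real m)
      * ((\<mu> * (real n / real r)) ^ m) powr (\<rho> / real m)"
    by (rule powr_mult)
  also have "((\<mu> * (real n / real r)) ^ m) powr (\<rho> / real m) = (\<mu> * (real n / real r)) powr \<rho>"
    using \<open>0 < \<mu>\<close> m by (simp add: powr_powr flip: powr_realpow')
  also have "(real m ^ m / fact m) powr (\<rho> / real m) * (\<mu> * (real n / real r)) powr \<rho>
      \<le> max 1 (C \<rho>) * (\<mu> * (real n / real r)) powr \<rho>"
    using power_over_fact_powr_le_C[OF \<open>0 < \<rho>\<close> m_def] by (intro mult_right_mono) auto
  also have "\<dots> < max 1 (C \<rho>) * (\<mu> * G) powr \<rho>"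
    using \<open>real n / real r < G\<close> \<open>0 < \<mu>\<close> \<open>0 < \<rho>\<close>
    by (intro mult_strict_left_mono powr_less_mono2) auto
  finally show ?thesis
    using moment(1) unfolding k \<mu>_def G_def by simp
qed

end
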